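(* The CN calculus is incomplete for epistemic weight models: there is a formula of $\mathcal{L}_{CN}$ that is true at every world of every epistemic weight model but is not derivable in the CN calculus.
   Context: Fix a set $P$ of proposition letters and a finite set $Ag$ of agents. The language $\mathcal{L}_{CN}$ is given by $\phi::=\top\mid p\mid\neg\phi\mid(\phi\wedge\phi)\mid B_a(\phi,\phi)$ with $p\in P$, $a\in Ag$. $\bot,\vee,\to,\leftrightarrow$ are defined as usual; $K_a\phi$ abbreviates $\neg B_a(\neg\phi,\top)$ and $\check K_a\phi$ abbreviates $\neg K_a\neg\phi$. An epistemic weight model is $\mathfrak{M}=(W,R,L,V)$ where $W$ is a non-empty countable set, $R$ assigns to each $a\in Ag$ an equivalence relation $\sim_a$ on $W$ (with $[w]_a$ the class of $w$), $L$ assigns to each $a\in Ag$ a function $\mathbb{L}_a:W\to\mathbb{Q}^+$ such that $\sum_{u\in[w]_a}\mathbb{L}_a(u)<\infty$ for all $a,w$, and $V:P\to\mathcal{P}(W)$. For $S\subseteq W$, $\mathbb{L}_a(S)=\sum_{u\in S}\mathbb{L}_a(u)$. Truth: $\top$ always true, $p$ true at $w$ iff $w\in V(p)$, Booleans as usual, and $\mathfrak{M},w\vDash B_a(\phi,\psi)$ iff $\mathbb{L}_a([w]_a\cap\llbracket\phi\wedge\psi\rrbracket_{\mathfrak{M}})>\mathbb{L}_a([w]_a\cap\llbracket\phi\wedge\neg\psi\rrbracket_{\mathfrak{M}})$, with $\llbracket\phi\rrbracket_{\mathfrak{M}}=\{v\mid\mathfrak{M},v\vDash\phi\}$. The CN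 calculus has axioms: (Taut) all propositional tautologies; (Dist-K) $K_a(\phi\to\psi)\to K_a\phi\to K_a\psi$; (T) $K_a\phi\to\phi$; (5B) $B_a(\phi,\psi)\to K_aB_a(\phi,\psi)$; (4B) $\neg B_a(\phi,\psi)\to K_a\neg B_a(\phi,\psi)$; (D) $B_a(\phi,\psi)\to\neg B_a(\phi,\neg\psi)$; (EC) $K_a(\phi\leftrightarrow\psi)\to B_a(\phi,\chi)\to B_a(\psi,\chi)$; (M) $K_a(\phi\to\psi)\to B_a(\chi,\phi)\to B_a(\chi,\psi)$; (C) $B_a(\phi,\psi)\to B_a(\phi,\phi\wedge\psi)$; (SC) $\neg B_a(\chi,\neg\phi)\wedge\check K_a(\chi\wedge\neg\phi\wedge\psi)\to B_a(\chi,\phi\vee\psi)$; rules Modus Ponens and (Nec-K): from $\phi$ infer $K_a\phi$.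
   Formalization: The sets of proposition letters and agents are assumed non-empty, with at least two letters or at least two agents; with no letters, no agents, or exactly one letter and one agent the CN calculus is complete and the claim fails. *)

theory Defs
  imports "HOL-Analysis.Analysis"
begin

text \<open>Proposition letters are the elements of the type \<open>'p\<close>, agents those of the type \<open>'ag\<close>.
  Types are nonempty; with no letters, with no agents, or with exactly one letter and one agent,
  incompleteness fails, hence the size assumption in the theorem.\<close>

datatype ('p, 'ag) fm =
    Top
  | Prop 'p
  | Neg "('p, 'ag) fm"
  | And "('p, 'ag) fm" "('p, 'ag) fm"
  | Bel 'ag "('p, 'ag) fm" "('p, 'ag) fm"

abbreviation Or :: "('p, 'ag) fm \<Rightarrow> ('p, 'ag) fm \<Rightarrow> ('p, 'ag) fm" where
  "Or \<phi> \<psi> \<equiv> Neg (And (Neg \<phi>) (Neg \<psi>))"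

abbreviation Imp :: "('p, 'ag) fm \<Rightarrow> ('p, 'ag) fm \<Rightarrow> ('p, 'ag) fm" where
  "Imp \<phi> \<psi> \<equiv> Neg (And \<phi> (Neg \<psi>))"

abbreviation Iff :: "('p, 'ag) fm \<Rightarrow> ('p, 'ag) fm \<Rightarrow> ('p, 'ag) fm" where
  "Iff \<phi> \<psi> \<equiv> And (Imp \<phi> \<psi>) (Imp \<psi> \<phi>)"

abbreviation Know :: "'ag \<Rightarrow> ('p, 'ag) fm \<Rightarrow> ('p, 'ag) fm" where
  "Know a \<phi> \<equiv> Neg (Bel a (Neg \<phi>) Top)"

abbreviation Poss :: "'ag \<Rightarrow> ('p, 'ag) fm \<Rightarrow> ('p, 'ag) fm" where
  "Poss a \<phi> \<equiv> Neg (Know a (Neg \<phi>))"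

record ('p, 'ag, 'w) weight_model =
  worlds :: "'w set"
  rel :: "'ag \<Rightarrow> ('w \<times> 'w) set"
  weight :: "'ag \<Rightarrow> 'w \<Rightarrow> rat"
  val :: "'p \<Rightarrow> 'w set"

abbreviation cell :: "('p, 'ag, 'w) weight_model \<Rightarrow> 'ag \<Rightarrow> 'w \<Rightarrow> 'w set" where
  "cell M a w \<equiv> rel M a `` {w}"

text \<open>The sum of the weights over an infinite cell may be irrational, so it is taken in the reals.\<close>

definition epistemic_weight_model :: "('p, 'ag, 'w) weight_model \<Rightarrow> bool" where
  "epistemic_weight_model M \<longleftrightarrow>
     worlds M \<noteq> {} \<and> countable (worlds M) \<and>
     (\<forall>a. equiv (worlds M) (rel M a)) \<and>
     (\<forall>a. \<forall>w\<in>worlds M. weight M a w > 0) \<and>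
     (\<forall>a. \<forall>w\<in>worlds M. (\<lambda>u. real_of_rat (weight M a u)) summable_on cell M a w) \<and>
     (\<forall>p. val M p \<subseteq> worlds M)"

definition total_weight :: "('p, 'ag, 'w) weight_model \<Rightarrow> 'ag \<Rightarrow> 'w set \<Rightarrow> real" where
  "total_weight M a S = (\<Sum>\<^sub>\<infinity>u\<in>S. real_of_rat (weight M a u))"

primrec sat :: "('p, 'ag, 'w) weight_model \<Rightarrow> 'w \<Rightarrow> ('p, 'ag) fm \<Rightarrow> bool" where
  "sat M w Top \<longleftrightarrow> True"
| "sat M w (Prop p) \<longleftrightarrow> w \<in> val M p"
| "sat M w (Neg \<phi>) \<longleftrightarrow> \<not> sat M w \<phi>"
| "sat M w (And \<phi> \<psi>) \<longleftrightarrow> sat M w \<phi> \<and> sat M w \<psi>"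
| "sat M w (Bel a \<phi> \<psi>) \<longleftrightarrow>
     total_weight M a (cell M a w \<inter> {v \<in> worlds M. sat M v \<phi> \<and> sat M v \<psi>})
       > total_weight M a (cell M a w \<inter> {v \<in> worlds M. sat M v \<phi> \<and> \<not> sat M v \<psi>})"

text \<open>Sets of worlds are countable, so sets of natural numbers represent all of them;
  the lemma \<open>ewm_valid_all_types\<close> transfers validity to models over any other type of worlds.\<close>

definition ewm_valid :: "('p, 'ag) fm \<Rightarrow> bool" where
  "ewm_valid \<phi> \<longleftrightarrow>
     (\<forall>M :: ('p, 'ag, nat) weight_model. epistemic_weight_model M \<longrightarrow> (\<forall>w\<in>worlds M. sat M w \<phi>))"

definition image_model :: "('w \<Rightarrow> 'v) \<Rightarrow> ('p, 'ag, 'w) weight_model \<Rightarrow> ('p, 'ag, 'v) weight_model" where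
  "image_model f M = \<lparr>worlds = f ` worlds M,
     rel = (\<lambda>a. map_prod f f ` rel M a),
     weight = (\<lambda>a v. weight M a (inv_into (worlds M) f v)),
     val = (\<lambda>p. f ` val M p)\<rparr>"

lemma image_model_cell:
  assumes "inj_on f (worlds M)" "equiv (worlds M) (rel M a)" "w \<in> worlds M"
  shows "cell (image_model f M) a (f w) = f ` cell M a w"
proof -
  have sub: "rel M a \<subseteq> worlds M \<times> worlds M"
    using assms(2) equiv_type by blast
  show ?thesis
  proof (intro equalityI subsetI)
    fix y assume "y \<in> cell (image_model f M) a (f w)"
    then obtain u v where uv: "(u, v) \<in> rel M a" "f u = f w" "y = f v"
      by (auto simp: image_model_def)
    with sub assms(1,3) have "u = w" by (auto dest: inj_onD)
    with uv show "y \<in> f ` cell M a w" by auto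
  next
    fix y assume "y \<in> f ` cell M a w"
    then show "y \<in> cell (image_model f M) a (f w)"
      by (auto simp: image_model_def intro!: rev_image_eqI)
  qed
qed

lemma image_model_total_weight:
  assumes "inj_on f (worlds M)" "S \<subseteq> worlds M"
  shows "total_weight (image_model f M) a (f ` S) = total_weight M a S"
proof -
  have inj: "inj_on f S" using assms inj_on_subset by blast
  show ?thesis
    unfolding total_weight_def infsum_reindex[OF inj]
    using assms by (intro infsum_cong) (auto simp: image_model_def subsetD)
qed

lemma image_model_sat:
  assumes inj: "inj_on f (worlds M)" and M: "epistemic_weight_model M"
  shows "w \<in> worlds M \<Longrightarrow> sat (image_model f M) (f w) \<phi> \<longleftrightarrow> sat M w \<phi>"
proof (induction \<phi> arbitrary: w)
  case (Prop p)
  have "val M p \<subseteq> worlds M" using M by (simp add: epistemic_weight_model_def)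
  with Prop inj show ?case by (auto simp: image_model_def dest: inj_onD)
next
  case (Bel a \<phi> \<psi>)
  have eq: "equiv (worlds M) (rel M a)" using M by (simp add: epistemic_weight_model_def)
  have key: "cell (image_model f M) a (f w) \<inter> {v \<in> worlds (image_model f M). Q v}
      = f ` (cell M a w \<inter> {v \<in> worlds M. P v})"
    if "\<And>v. v \<in> worlds M \<Longrightarrow> Q (f v) = P v" for P Q
  proof -
    have sub: "cell M a w \<subseteq> worlds M"
      using equiv_type[OF eq] by auto
    have "worlds (image_model f M) = f ` worlds M" by (simp add: image_model_def)
    then show ?thesis
      unfolding image_model_cell[OF inj eq Bel.prems]
      using sub inj that by (auto simp del: Image_singleton_iff dest!: inj_onD[OF inj])
  qed
  show ?case
    by (simp add: key[of "\<lambda>v. sat (image_model f M) v \<phi> \<and> sat (image_model f M) v \<psi>"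
                        "\<lambda>v. sat M v \<phi> \<and> sat M v \<psi>"]
                  key[of "\<lambda>v. sat (image_model f M) v \<phi> \<and> \<not> sat (image_model f M) v \<psi>"
                        "\<lambda>v. sat M v \<phi> \<and> \<not> sat M v \<psi>"]
                  Bel.IH image_model_total_weight[OF inj] le_infI2 subset_iff)
qed auto

lemma image_model_epistemic_weight_model:
  assumes inj: "inj_on f (worlds M)" and M: "epistemic_weight_model M"
  shows "epistemic_weight_model (image_model f M)"
proof -
  have eq: "equiv (worlds M) (rel M a)" for a
    using M by (simp add: epistemic_weight_model_def)
  have sub: "rel M a \<subseteq> worlds M \<times> worlds M" for a
    using eq equiv_type by blast
  have "equiv (f ` worlds M) (map_prod f f ` rel M a)" for a
  proof (rule equivI)
    show "map_prod f f ` rel M a \<subseteq> f ` worlds M \<times> f ` worlds M"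
      using sub[of a] by auto
    show "refl_on (f ` worlds M) (map_prod f f ` rel M a)"
      using eq[of a] by (auto simp: refl_on_def equiv_def intro!: rev_image_eqI)
    show "sym (map_prod f f ` rel M a)"
      using eq[of a] by (force simp: sym_def equiv_def)
    show "trans (map_prod f f ` rel M a)"
    proof (rule transI)
      fix x y z
      assume "(x, y) \<in> map_prod f f ` rel M a" "(y, z) \<in> map_prod f f ` rel M a"
      then obtain u v v' t where *: "(u, v) \<in> rel M a" "x = f u" "y = f v"
        "(v', t) \<in> rel M a" "y = f v'" "z = f t" by auto
      with sub[of a] inj have "v' = v" by (auto dest: inj_onD)
      with * eq[of a] have "(u, t) \<in> rel M a" by (auto simp: equiv_def dest: transD)
      then have "map_prod f f (u, t) \<in> map_prod f f ` rel M a" by (rule imageI)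
      with * show "(x, z) \<in> map_prod f f ` rel M a" by simp
    qed
  qed
  moreover have "(\<lambda>u. real_of_rat (weight (image_model f M) a u)) summable_on
      cell (image_model f M) a (f w)" if w: "w \<in> worlds M" for a w
  proof -
    have cs: "cell M a w \<subseteq> worlds M" using sub[of a] by auto
    then have "inj_on f (cell M a w)" using inj inj_on_subset by blast
    moreover have "(\<lambda>u. real_of_rat (weight M a u)) summable_on cell M a w"
      using M w by (simp add: epistemic_weight_model_def)
    then have "((\<lambda>u. real_of_rat (weight (image_model f M) a u)) \<circ> f) summable_on cell M a w"
      by (rule summable_on_cong[THEN iffD1, rotated]) (use cs inj in \<open>auto simp: image_model_def\<close>)
    ultimately show ?thesis
      unfolding image_model_cell[OF inj eq w] using summable_on_reindex by blast
  qed
  moreover have "\<forall>a. \<forall>w\<in>worlds M. weight M a (inv_into (worlds M) f (f w)) > 0"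
    using M inj by (simp add: epistemic_weight_model_def)
  moreover have "\<forall>p. f ` val M p \<subseteq> f ` worlds M"
    using M by (simp add: epistemic_weight_model_def image_mono)
  ultimately show ?thesis
    using M by (simp add: epistemic_weight_model_def image_model_def)
qed

lemma ewm_valid_all_types:
  fixes M :: "('p, 'ag, 'w) weight_model"
  assumes "ewm_valid \<phi>" "epistemic_weight_model M" "w \<in> worlds M"
  shows "sat M w \<phi>"
proof -
  let ?f = "to_nat_on (worlds M)"
  have inj: "inj_on ?f (worlds M)"
    using assms(2) inj_on_to_nat_on unfolding epistemic_weight_model_def by blast
  have "sat (image_model ?f M) (?f w) \<phi>"
    using assms(1,3) image_model_epistemic_weight_model[OF inj assms(2)]
    by (auto simp: ewm_valid_def image_model_def)
  then show ?thesis
    using image_model_sat[OF inj assms(2,3)] by simp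
qed

text \<open>Tautologies are evaluated with proposition letters and formulas \<open>Bel a \<phi> \<psi>\<close>
  as propositional atoms.\<close>

primrec bool_eval :: "(('p, 'ag) fm \<Rightarrow> bool) \<Rightarrow> ('p, 'ag) fm \<Rightarrow> bool" where
  "bool_eval v Top \<longleftrightarrow> True"
| "bool_eval v (Prop p) \<longleftrightarrow> v (Prop p)"
| "bool_eval v (Neg \<phi>) \<longleftrightarrow> \<not> bool_eval v \<phi>"
| "bool_eval v (And \<phi> \<psi>) \<longleftrightarrow> bool_eval v \<phi> \<and> bool_eval v \<psi>"
| "bool_eval v (Bel a \<phi> \<psi>) \<longleftrightarrow> v (Bel a \<phi> \<psi>)"

definition tautology :: "('p, 'ag) fm \<Rightarrow> bool" where
  "tautology \<phi> \<longleftrightarrow> (\<forall>v. bool_eval v \<phi>)"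

inductive CN :: "('p, 'ag) fm \<Rightarrow> bool" where
  Taut: "tautology \<phi> \<Longrightarrow> CN \<phi>"
| DistK: "CN (Imp (Know a (Imp \<phi> \<psi>)) (Imp (Know a \<phi>) (Know a \<psi>)))"
| T: "CN (Imp (Know a \<phi>) \<phi>)"
| B5: "CN (Imp (Bel a \<phi> \<psi>) (Know a (Bel a \<phi> \<psi>)))"
| B4: "CN (Imp (Neg (Bel a \<phi> \<psi>)) (Know a (Neg (Bel a \<phi> \<psi>))))"
| D: "CN (Imp (Bel a \<phi> \<psi>) (Neg (Bel a \<phi> (Neg \<psi>))))"
| EC: "CN (Imp (Know a (Iff \<phi> \<psi>)) (Imp (Bel a \<phi> \<theta>) (Bel a \<psi> \<theta>)))"
| M: "CN (Imp (Know a (Imp \<phi> \<psi>)) (Imp (Bel a \<theta> \<phi>) (Bel a \<theta> \<psi>)))"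
| C: "CN (Imp (Bel a \<phi> \<psi>) (Bel a \<phi> (And \<phi> \<psi>)))"
| SC: "CN (Imp (And (Neg (Bel a \<theta> (Neg \<phi>))) (Poss a (And (And \<theta> (Neg \<phi>)) \<psi>)))
              (Bel a \<theta> (Or \<phi> \<psi>)))"
| MP: "CN (Imp \<phi> \<psi>) \<Longrightarrow> CN \<phi> \<Longrightarrow> CN \<psi>"
| NecK: "CN \<phi> \<Longrightarrow> CN (Know a \<phi>)"

end

theory Submission
  imports Defs
begin

text \<open>No axiom of the calculus relates conditional beliefs under inequivalent conditions,
  except for knowledge. For disjoint \<open>\<alpha>\<close> and \<open>\<beta>\<close>, the formula \<open>B\<^sub>a(\<alpha> \<or> \<beta>, \<alpha>)\<close> says that \<open>\<alpha>\<close> has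
  greater weight than \<open>\<beta>\<close>, and this comparison is transitive in every weight model. The calculus
  is sound, however, for models in which weights are replaced by an abstract comparison of sets,
  and such a comparison may be cyclic on three singletons: compare by cardinality and break ties
  between the singletons cyclically. Either two letters, or one letter and a second agent, suffice
  to define the three worlds.\<close>

locale comparison_model =
  fixes info :: "'ag \<Rightarrow> 'w \<Rightarrow> 'w set"
    and heavier :: "'ag \<Rightarrow> 'w set \<Rightarrow> 'w set \<Rightarrow> bool"
    and V :: "'p \<Rightarrow> 'w set"
  assumes info_refl: "w \<in> info a w"
    and info_eq: "v \<in> info a w \<Longrightarrow> info a v = info a w"
    and heavier_asym: "heavier a A B \<Longrightarrow> \<not> heavier a B A"
    and heavier_mono: "heavier a A B \<Longrightarrow> A \<subseteq> A' \<Longrightarrow> B' \<subseteq> B \<Longrightarrow> heavier a A' B'"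
    and heavier_transfer: "\<not> heavier a B A \<Longrightarrow> A \<inter> B = {} \<Longrightarrow> C \<subseteq> B \<Longrightarrow> C \<noteq> {} \<Longrightarrow>
      heavier a (A \<union> C) (B - C)"
begin

primrec truth :: "('p, 'ag) fm \<Rightarrow> 'w set" where
  "truth Top = UNIV"
| "truth (Prop p) = V p"
| "truth (Neg \<phi>) = - truth \<phi>"
| "truth (And \<phi> \<psi>) = truth \<phi> \<inter> truth \<psi>"
| "truth (Bel a \<phi> \<psi>) =
     {w. heavier a (info a w \<inter> truth \<phi> \<inter> truth \<psi>) (info a w \<inter> truth \<phi> - truth \<psi>)}"

text \<open>If \<open>heavier a A {}\<close> failed for a nonempty \<open>A\<close>, then
  \<open>heavier_transfer\<close>, moving all of \<open>A\<close> to the empty side, would yield it;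
  asymmetry excludes \<open>A = {}\<close>. This makes \<open>Know a\<close>, defined through
  \<open>Bel\<close>, quantify over the whole cell.\<close>

lemma heavier_empty_iff [simp]: "heavier a A {} \<longleftrightarrow> A \<noteq> {}"
  using heavier_asym[of a A "{}"] heavier_transfer[of a A "{}" A] by auto

lemma truth_Know [simp]: "truth (Know a \<phi>) = {w. info a w \<subseteq> truth \<phi>}"
  by auto

lemma bool_eval_truth: "bool_eval (\<lambda>\<psi>. w \<in> truth \<psi>) \<phi> \<longleftrightarrow> w \<in> truth \<phi>"
  by (induction \<phi>) auto

text \<open>This is \<open>heavier_transfer\<close> with the nonempty part of \<open>X - Y\<close>
  inside \<open>Z\<close> moved over to \<open>X \<inter> Y\<close>.\<close>

lemma SC_sound:
  assumes "\<not> heavier a (X - Y) (X \<inter> Y)" "(X - Y) \<inter> Z \<noteq> {}"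
  shows "heavier a (X \<inter> (Y \<union> Z)) (X - (Y \<union> Z))"
proof -
  have "heavier a (X \<inter> Y \<union> (X - Y) \<inter> Z) (X - Y - (X - Y) \<inter> Z)"
    using assms by (intro heavier_transfer) auto
  moreover have "X \<inter> Y \<union> (X - Y) \<inter> Z = X \<inter> (Y \<union> Z)" "X - Y - (X - Y) \<inter> Z = X - (Y \<union> Z)"
    by auto
  ultimately show ?thesis by simp
qed

theorem CN_sound: "CN \<phi> \<Longrightarrow> w \<in> truth \<phi>"
proof (induction arbitrary: w rule: CN.induct)
  case (Taut \<phi>)
  then show ?case using bool_eval_truth unfolding tautology_def by blast
next
  case (T a \<phi>)
  show ?case using info_refl[of w a] by auto
next
  \<comment> \<open>The truth of a belief at a world depends only on the cell, which is shared by
    all its members.\<close>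
  case (B5 a \<phi> \<psi>)
  show ?case by (auto dest: info_eq)
next
  case (B4 a \<phi> \<psi>)
  show ?case by (auto dest: info_eq)
next
  case (D a \<phi> \<psi>)
  show ?case by (auto dest: heavier_asym simp: Diff_eq)
next
  case (EC a \<phi> \<psi> \<theta>)
  have "info a w \<inter> truth \<phi> = info a w \<inter> truth \<psi>" if "w \<in> truth (Know a (Iff \<phi> \<psi>))"
    using that by auto
  then show ?case by (auto simp del: truth_Know)
next
  case (M a \<phi> \<psi> \<theta>)
  show ?case by (auto elim!: heavier_mono)
next
  case (C a \<phi> \<psi>)
  show ?case by (auto elim!: heavier_mono)
next
  case (SC a \<theta> \<phi> \<psi>)
  show ?case
    using SC_sound[of a "info a w \<inter> truth \<theta>" "truth \<phi>" "truth \<psi>"]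
    by (auto simp: Diff_eq Int_assoc)
qed auto

end

text \<open>Any asymmetric \<open>tie\<close> will do: a strictly larger first set or a strictly
  smaller second set leaves the tied case, and transferring a nonempty set always produces strictly
  more elements.\<close>

lemma comparison_model_card:
  fixes info :: "'ag \<Rightarrow> 'w :: finite \<Rightarrow> 'w set"
  assumes "\<And>a w. w \<in> info a w" "\<And>a v w. v \<in> info a w \<Longrightarrow> info a v = info a w"
    and asym: "\<And>a A B. tie a A B \<Longrightarrow> \<not> tie a B A"
  shows "comparison_model info
    (\<lambda>a A B. card B < card A \<or> card B = card A \<and> tie a A B)"
proof
  fix a and A B A' B' :: "'w set"
  assume *: "card B < card A \<or> card B = card A \<and> tie a A B" "A \<subseteq> A'" "B' \<subseteq> B"
  then have "card A < card A' \<or> A = A'" "card B' < card B \<or> B' = B"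
    by (meson finite psubset_card_mono psubsetI)+
  with * show "card B' < card A' \<or> card B' = card A' \<and> tie a A' B'"
    by auto
next
  fix a and A B C :: "'w set"
  assume *: "\<not> (card A < card B \<or> card A = card B \<and> tie a B A)" "A \<inter> B = {}" "C \<subseteq> B" "C \<noteq> {}"
  then have "A \<subset> A \<union> C" by auto
  then have "card A < card (A \<union> C)" by (simp add: psubset_card_mono)
  moreover have "card (B - C) \<le> card B" by (simp add: card_mono)
  ultimately show "card (B - C) < card (A \<union> C) \<or>
      card (B - C) = card (A \<union> C) \<and> tie a (A \<union> C) (B - C)"
    using * by linarith
qed (rule assms(1), erule assms(2), auto dest: asym)

abbreviation comparison_trans :: "'ag \<Rightarrow> ('p, 'ag) fm \<Rightarrow> ('p, 'ag) fm \<Rightarrow> ('p, 'ag) fm \<Rightarrow> ('p, 'ag) fm"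
  where
  "comparison_trans a \<alpha> \<beta> \<gamma> \<equiv>
     Imp (And (Bel a (Or \<alpha> \<beta>) \<alpha>) (Bel a (Or \<beta> \<gamma>) \<beta>)) (Bel a (Or \<alpha> \<gamma>) \<alpha>)"

lemma sat_Bel_Or:
  assumes "\<And>v. \<not> (sat M v \<alpha> \<and> sat M v \<beta>)"
  shows "sat M w (Bel a (Or \<alpha> \<beta>) \<alpha>) \<longleftrightarrow>
    total_weight M a (cell M a w \<inter> {v \<in> worlds M. sat M v \<beta>})
    < total_weight M a (cell M a w \<inter> {v \<in> worlds M. sat M v \<alpha>})"
proof -
  have "{v \<in> worlds M. sat M v (Or \<alpha> \<beta>) \<and> sat M v \<alpha>} = {v \<in> worlds M. sat M v \<alpha>}"
    "{v \<in> worlds M. sat M v (Or \<alpha> \<beta>) \<and> \<not> sat M v \<alpha>} = {v \<in> worlds M. sat M v \<beta>}"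
    using assms by auto
  then show ?thesis by (simp del: sat.simps(3,4) add: sat.simps(5))
qed

text \<open>The three formulas exclude each other for all \<phi> and \<psi>, so the claim reduces to
  transitivity of the order on the reals.\<close>

lemma ewm_valid_comparison_trans:
  "ewm_valid (comparison_trans a (And \<phi> \<psi>) (And \<phi> (Neg \<psi>)) (Neg \<phi>))"
proof -
  have "sat M w (comparison_trans a (And \<phi> \<psi>) (And \<phi> (Neg \<psi>)) (Neg \<phi>))"
    for M :: "('a, 'b, nat) weight_model" and w
    unfolding sat.simps(3,4)[of M w]
    by (subst (1 2 3) sat_Bel_Or) auto
  then show ?thesis by (auto simp: ewm_valid_def)
qed

text \<open>Agent \<open>a\<close> distinguishes no worlds and carries the cyclic comparison. Every
  other agent separates 2 from 1 and 3, so that its knowledge can help to define the worlds.\<close>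

definition cycle_info :: "'ag \<Rightarrow> 'ag \<Rightarrow> 3 \<Rightarrow> 3 set" where
  "cycle_info a c w = (if c = a then UNIV else if w = 2 then {2} else {1, 3})"

definition cycle_heavier :: "'ag \<Rightarrow> 'ag \<Rightarrow> 3 set \<Rightarrow> 3 set \<Rightarrow> bool" where
  "cycle_heavier a c A B \<longleftrightarrow> card B < card A \<or>
     card B = card A \<and> c = a \<and> (A, B) \<in> {({1}, {2}), ({2}, {3}), ({3}, {1})}"

lemma compl_12: "- {1, 2} = {3 :: 3}"
  using UNIV_3 by auto

lemma cycle_model: "comparison_model (cycle_info a) (cycle_heavier a)"
  unfolding cycle_heavier_def
  by (rule comparison_model_card)
    (auto simp: cycle_info_def split: if_splits intro: exhaust_3[THEN disjE])

text \<open>The compared formulas define the singletons of 1, 2 and 3. Since \<psi> occurs only in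
  conjunction with \<phi>, its trace on {1, 2} is what matters.\<close>

lemma not_CN_comparison_trans:
  assumes "comparison_model.truth (cycle_info a) (cycle_heavier a) V \<phi> = {1, 2}"
    and "comparison_model.truth (cycle_info a) (cycle_heavier a) V \<psi> \<inter> {1, 2} = {1}"
  shows "\<not> CN (comparison_trans a (And \<phi> \<psi>) (And \<phi> (Neg \<psi>)) (Neg \<phi>))"
proof
  interpret comparison_model "cycle_info a" "cycle_heavier a" V
    by (rule cycle_model)
  assume "CN (comparison_trans a (And \<phi> \<psi>) (And \<phi> (Neg \<psi>)) (Neg \<phi>))"
  then have w: "1 \<in> truth (comparison_trans a (And \<phi> \<psi>) (And \<phi> (Neg \<psi>)) (Neg \<phi>))"
    by (rule CN_sound)
  have psi: "1 \<in> truth \<psi>" "2 \<notin> truth \<psi>"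
    using eqset_imp_iff[OF assms(2), of 1] eqset_imp_iff[OF assms(2), of 2] by simp_all
  have t: "truth (And \<phi> \<psi>) = {1}" "truth (And \<phi> (Neg \<psi>)) = {2}" "truth (Neg \<phi>) = {3}"
    using assms(1) psi by (auto simp: compl_12)
  have Bel: "1 \<in> truth (Bel a (Or \<xi> \<theta>) \<xi>) \<longleftrightarrow> cycle_heavier a a X Y"
    if "truth \<xi> = X" "truth \<theta> = Y" "X \<inter> Y = {}" for \<xi> \<theta> X Y
  proof -
    have "(X \<union> Y) \<inter> X = X" "X \<union> Y - X = Y"
      using that by auto
    then show ?thesis
      using that by (simp add: cycle_info_def)
  qed
  have disj: "{1} \<inter> {2 :: 3} = {}" "{2} \<inter> {3 :: 3} = {}" "{1} \<inter> {3 :: 3} = {}"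
    by auto
  have imp: "1 \<in> truth (Imp (And \<xi> \<theta>) \<delta>) \<longleftrightarrow> (1 \<in> truth \<xi> \<longrightarrow> 1 \<in> truth \<theta> \<longrightarrow> 1 \<in> truth \<delta>)"
    for \<xi> \<theta> \<delta>
    by auto
  \<comment> \<open>The two premises are ties won along the cycle; the conclusion is the tie that
    the cycle awards to {3}.\<close>
  have "cycle_heavier a a {1} {2} \<longrightarrow> cycle_heavier a a {2} {3} \<longrightarrow> cycle_heavier a a {1} {3}"
    using w unfolding imp Bel[OF t(1,2) disj(1)] Bel[OF t(2,3) disj(2)] Bel[OF t(1,3) disj(3)] .
  then show False by (simp add: cycle_heavier_def)
qed

theorem theorem3:
  assumes "(\<exists>p q :: 'p. p \<noteq> q) \<or> (\<exists>a b :: 'ag :: finite. a \<noteq> b)"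
  shows "\<exists>\<phi> :: ('p, 'ag) fm. ewm_valid \<phi> \<and> \<not> CN \<phi>"
  using assms
proof (elim disjE exE)
  fix p q :: 'p
  assume "p \<noteq> q"
  fix a :: 'ag
  \<comment> \<open>The letter \<open>p\<close> is false only at 3, and \<open>q\<close> separates 1
    from 2.\<close>
  obtain V :: "'p \<Rightarrow> 3 set" where V: "V p = {1, 2}" "V q = {1}"
    using that[of "\<lambda>r. if r = p then {1, 2} else {1}"] \<open>p \<noteq> q\<close> by auto
  interpret comparison_model "cycle_info a" "cycle_heavier a" V
    by (rule cycle_model)
  have "truth (Prop p) = {1, 2}" "truth (Prop q) \<inter> {1, 2} = {1}"
    by (simp_all add: V)
  then show ?thesis
    by (intro exI conjI) (rule ewm_valid_comparison_trans, rule not_CN_comparison_trans)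
next
  fix a b :: 'ag and p :: 'p
  assume "a \<noteq> b"
  obtain V :: "'p \<Rightarrow> 3 set" where V: "V p = {1, 2}"
    by (rule that) (rule refl)
  interpret comparison_model "cycle_info a" "cycle_heavier a" V
    by (rule cycle_model)
  \<comment> \<open>The cell {2} of \<open>b\<close> lies within {1, 2} and the cell {1, 3} does
    not, so \<open>Neg (Know b (Prop p))\<close> can take the place of the second letter.\<close>
  have "truth (Know b (Prop p)) = {2}"
    using \<open>a \<noteq> b\<close> exhaust_3 by (auto simp: V cycle_info_def)
  then have "truth (Prop p) = {1, 2}" "truth (Neg (Know b (Prop p))) \<inter> {1, 2} = {1}"
    by (auto simp: V simp del: truth_Know)
  then show ?thesis
    by (intro exI conjI) (rule ewm_valid_comparison_trans, rule not_CN_comparison_trans)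
qed

end
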